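(* For every integer $n\ge 1$, $$\sum_{k=0}^{n-1}{2n\brack 2k+1}_q(-q;q)_{2n-2k-2}(-1)^kE_{2k+1}(q)=(-q;q)_{2n-1}.$$
   Context: For a nonnegative integer $m$, $(t;q)_m=\prod_{i=0}^{m-1}(1-tq^i)$ with $(t;q)_0=1$; thus $(-q;q)_m=(1+q)(1+q^2)\cdots(1+q^m)$. The $q$-binomial coefficients are ${n\brack k}_q=\frac{(q;q)_n}{(q;q)_{n-k}(q;q)_k}$ for $0\le k\le n$ and $0$ otherwise. Define $\sin_q(x)=\sum_{n\ge0}(-1)^n\frac{x^{2n+1}}{(q;q)_{2n+1}}$ and $\cos_q(x)=\sum_{n\ge0}(-1)^n\frac{x^{2n}}{(q;q)_{2n}}$; the $q$-tangent numbers $E_{2n+1}(q)$ are defined by $\frac{\sin_q(x)}{\cos_q(x)}=\sum_{n\ge0}E_{2n+1}(q)\frac{x^{2n+1}}{(q;q)_{2n+1}}$. (Equivalently, $E_{2n+1}(q)=\sum_{\pi}q^{\mathrm{inv}(\pi)}$ over permutations $\pi$ of $[2n+1]$ with $\pi_1>\pi_2<\pi_3>\pi_4<\cdots$, where $\mathrm{inv}(\pi)$ is the number of pairs $i<j$ with $\pi_i>\pi_j$.) *)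

theory Defs
  imports "HOL-Computational_Algebra.Computational_Algebra"
begin

text \<open>
  The parameter \<open>q\<close> is an element of an arbitrary field. The indeterminate \<open>q\<close> of the literature
  is the instance where the field is that of the rational functions over \<open>\<rat>\<close>; see
  \<open>indeterminate_not_root_of_unity\<close> below.
\<close>

definition qpoch :: "'a::field \<Rightarrow> 'a \<Rightarrow> nat \<Rightarrow> 'a" where
  "qpoch t q m = (\<Prod>i<m. 1 - t * q ^ i)"

definition qbinom :: "'a::field \<Rightarrow> nat \<Rightarrow> nat \<Rightarrow> 'a" where
  "qbinom q n k = (if k \<le> n then qpoch q q n / (qpoch q q (n - k) * qpoch q q k) else 0)"

definition sin_q :: "'a::field \<Rightarrow> 'a fps" where
  "sin_q q = Abs_fps (\<lambda>m. if odd m then (-1) ^ (m div 2) / qpoch q q m else 0)"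

definition cos_q :: "'a::field \<Rightarrow> 'a fps" where
  "cos_q q = Abs_fps (\<lambda>m. if even m then (-1) ^ (m div 2) / qpoch q q m else 0)"

text \<open>
  The argument is the full (odd) index: the number \<open>E\<^sub>2\<^sub>n\<^sub>+\<^sub>1(q)\<close> is
  \<open>q_tangent_number q (2 * n + 1)\<close>. Values at even indices are zero (they are not secant numbers).
\<close>

definition q_tangent_number :: "'a::field \<Rightarrow> nat \<Rightarrow> 'a" where
  "q_tangent_number q m = fps_nth (sin_q q / cos_q q) m * qpoch q q m"

lemma qpoch_nonzero:
  assumes "\<And>m. m \<ge> 1 \<Longrightarrow> q ^ m \<noteq> 1"
  shows "qpoch q q m \<noteq> 0"
proof -
  have "1 - q * q ^ i \<noteq> 0" for i
    using assms[of "Suc i"] by simp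
  then show ?thesis by (simp add: qpoch_def)
qed

lemma fps_nth_sin_q_over_cos_q_even:
  assumes "even m"
  shows "fps_nth (sin_q q / cos_q q) m = 0"
  using assms
proof (induction m rule: less_induct)
  case (less m)
  let ?T = "sin_q q / cos_q q"
  have c0: "fps_nth (cos_q q) 0 = 1"
    by (simp add: cos_q_def qpoch_def)
  then have "sin_q q = cos_q q * ?T"
    by (simp add: fps_divide_unit inverse_mult_eq_1' mult.left_commute mult.commute)
  then have "0 = fps_nth (cos_q q * ?T) m"
    using less.prems by (metis (mono_tags, lifting) fps_nth_Abs_fps sin_q_def)
  also have "\<dots> = (\<Sum>i=0..m. fps_nth (cos_q q) i * fps_nth ?T (m - i))"
    by (rule fps_mult_nth)
  also have "\<dots> = fps_nth ?T m
      + (\<Sum>i\<in>{0<..m}. fps_nth (cos_q q) i * fps_nth ?T (m - i))"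
    by (simp add: sum.head c0)
  also have "(\<Sum>i\<in>{0<..m}. fps_nth (cos_q q) i * fps_nth ?T (m - i)) = 0"
  proof (rule sum.neutral, rule ballI)
    fix i assume i: "i \<in> {0<..m}"
    show "fps_nth (cos_q q) i * fps_nth ?T (m - i) = 0"
    proof (cases "even i")
      case True
      then show ?thesis using less.IH[of "m - i"] less.prems i by auto
    next
      case False
      then show ?thesis by (simp add: cos_q_def)
    qed
  qed
  finally show ?case by simp
qed

lemma sin_q_over_cos_q:
  assumes "\<And>m. m \<ge> 1 \<Longrightarrow> q ^ m \<noteq> 1"
  shows "sin_q q / cos_q q =
    Abs_fps (\<lambda>m. if odd m then q_tangent_number q m / qpoch q q m else 0)"
  using qpoch_nonzero[OF assms]
  by (auto simp: fps_eq_iff q_tangent_number_def fps_nth_sin_q_over_cos_q_even)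

lemma indeterminate_not_root_of_unity:
  assumes "m \<ge> 1"
  shows "to_fract [:0, 1 :: rat:] ^ m \<noteq> 1"
proof
  have "to_fract ([:0, 1 :: rat:] ^ m) = to_fract [:0, 1 :: rat:] ^ m"
    by (induction m) (simp_all only: power_0 power_Suc to_fract_mult to_fract_1)
  also assume "to_fract [:0, 1 :: rat:] ^ m = 1"
  finally have "to_fract ([:0, 1 :: rat:] ^ m) = to_fract 1" by simp
  then have "[:0, 1 :: rat:] ^ m = 1"
    by (simp only: to_fract_eq_iff)
  then have "poly ([:0, 1 :: rat:] ^ m) 0 = poly 1 0" by simp
  then show False using assms by (simp add: power_0_left split: if_splits)
qed

end

theory Submission
  imports Defs
begin

text \<open>
  Let \<open>C\<close> and \<open>S\<close> be the even and odd parts of \<open>e(x) = \<Sum> x\<^sup>m / (q;q)\<^sub>m\<close>, so that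
  \<open>e(-x) = C - S\<close>, and let \<open>G = \<Sum>\<^sub>j\<^sub>\<ge>\<^sub>1 (-q;q)\<^sub>j\<^sub>-\<^sub>1 x\<^sup>j / (q;q)\<^sub>j\<close>. Both \<open>G(x) e(-x)\<close> and \<open>S\<close> solve
  \<open>(1 - x) h(x) = h(qx) + x e(-x)\<close> with \<open>h(0) = 0\<close>, and this equation has only one solution, so
  \<open>G (C - S) = S\<close>. If \<open>A\<close> and \<open>B\<close> are the odd and even parts of \<open>G\<close>, the even part of this identity
  reads \<open>B C = A S\<close>. The signed \<open>q\<close>-tangent numbers have generating function \<open>S / C\<close>, hence
  \<open>(S / C) A = B\<close>, and the theorem compares coefficients of \<open>x\<^sup>2\<^sup>n\<close>.
\<close>

definition qexp :: "'a::field \<Rightarrow> 'a fps" where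
  "qexp q = Abs_fps (\<lambda>m. 1 / qpoch q q m)"

definition qexp_neg :: "'a::field \<Rightarrow> 'a fps" where
  "qexp_neg q = Abs_fps (\<lambda>m. (-1) ^ m / qpoch q q m)"

text \<open>Truncated subtraction alone would make the constant term 1; it must be 0 because
  \<open>S\<close> has none.\<close>

definition G_q :: "'a::field \<Rightarrow> 'a fps" where
  "G_q q = Abs_fps (\<lambda>j. if j = 0 then 0 else qpoch (-q) q (j - 1) / qpoch q q j)"

definition fps_dilate :: "'a::field \<Rightarrow> 'a fps \<Rightarrow> 'a fps" where
  "fps_dilate q f = fps_compose f (fps_const q * fps_X)"

definition fps_even_part :: "'a::zero fps \<Rightarrow> 'a fps" where
  "fps_even_part f = Abs_fps (\<lambda>m. if even m then fps_nth f m else 0)"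

definition fps_odd_part :: "'a::zero fps \<Rightarrow> 'a fps" where
  "fps_odd_part f = Abs_fps (\<lambda>m. if odd m then fps_nth f m else 0)"

text \<open>The \<open>q\<close>-analogue of tanh. Signs replace the substitution of ix for x, as
  the field need not contain a square root of -1.\<close>

definition signed_tan_q :: "'a::field \<Rightarrow> 'a fps" where
  "signed_tan_q q =
    Abs_fps (\<lambda>m. if odd m then (-1) ^ (m div 2) * fps_nth (sin_q q / cos_q q) m else 0)"

lemma qpoch_0 [simp]: "qpoch t q 0 = 1"
  by (simp add: qpoch_def)

lemma qpoch_Suc: "qpoch t q (Suc m) = qpoch t q m * (1 - t * q ^ m)"
  by (simp add: qpoch_def)

lemma fps_nth_dilate: "fps_nth (fps_dilate q f) n = q ^ n * fps_nth f n"
  by (simp add: fps_dilate_def fps_compose_linear)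

lemma fps_dilate_mult: "fps_dilate q (f * g) = fps_dilate q f * fps_dilate q g"
  by (simp add: fps_dilate_def fps_compose_mult_distrib)

lemma fps_dilate_diff: "fps_dilate q (f - g) = fps_dilate q f - fps_dilate q g"
  by (simp add: fps_eq_iff fps_nth_dilate algebra_simps)

text \<open>Comparing coefficients gives (1 - q^(n+1)) D_(n+1) = D_n, so zero propagates from
  D_0.\<close>

lemma one_minus_X_mult_eq_dilate_imp_0:
  fixes q :: "'a::field"
  assumes q: "\<And>m. m \<ge> 1 \<Longrightarrow> q ^ m \<noteq> 1"
    and D: "(1 - fps_X) * D = fps_dilate q D" and D0: "fps_nth D 0 = 0"
  shows "D = 0"
proof -
  have "fps_nth D n = 0" for n
  proof (induction n)
    case 0
    show ?case by (rule D0)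
  next
    case (Suc n)
    have "fps_nth ((1 - fps_X) * D) (Suc n) = q ^ Suc n * fps_nth D (Suc n)"
      by (simp only: D fps_nth_dilate)
    with Suc have "fps_nth D (Suc n) * (1 - q ^ Suc n) = 0"
      by (simp add: algebra_simps)
    moreover have "1 - q ^ Suc n \<noteq> 0" using q[of "Suc n"] by simp
    ultimately show ?case by (metis mult_eq_0_iff)
  qed
  then show ?thesis by (simp add: fps_eq_iff)
qed

context
  fixes q :: "'a::field"
  assumes q: "\<And>m. m \<ge> 1 \<Longrightarrow> q ^ m \<noteq> 1"
begin

private lemma nz: "qpoch q q m \<noteq> 0"
  by (rule qpoch_nonzero) (rule q)

private lemma nz_factor: "1 - q * q ^ n \<noteq> 0"
  using q[of "Suc n"] by simp

lemma dilate_qexp_neg: "fps_dilate q (qexp_neg q) = (1 + fps_X) * qexp_neg q"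
proof (rule fps_ext)
  fix n
  show "fps_nth (fps_dilate q (qexp_neg q)) n = fps_nth ((1 + fps_X) * qexp_neg q) n"
    using nz nz_factor
    by (cases n)
       (auto simp: fps_nth_dilate qexp_neg_def qpoch_Suc ring_distribs(1,2) divide_simps,
        auto simp: algebra_simps)
qed

text \<open>For m >= 1 this encodes (1 - q^(m+1)) G_(m+1) = (1 + q^m) G_m; the summand
  \<open>fps_X\<close> accounts for G_1 = 1/(1 - q).\<close>

lemma G_q_functional_eq:
  "(1 - fps_X) * G_q q = (1 + fps_X) * fps_dilate q (G_q q) + fps_X"
proof (rule fps_ext)
  fix n
  show "fps_nth ((1 - fps_X) * G_q q) n = fps_nth ((1 + fps_X) * fps_dilate q (G_q q) + fps_X) n"
  proof (cases n)
    case 0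
    then show ?thesis by (simp add: fps_nth_dilate G_q_def)
  next
    case (Suc m)
    then show ?thesis
      using nz nz_factor nz_factor[of "Suc _"]
      by (cases m)
       (auto simp: fps_nth_dilate G_q_def qpoch_Suc ring_distribs(1,2) left_diff_distrib divide_simps,
        auto simp: algebra_simps)
  qed
qed

text \<open>Since (1 - q^(n+1)) / (q;q)_(n+1) = 1 / (q;q)_n, the coefficient of x^(n+1) reduces to
  [n even] - [n odd] = (-1)^n.\<close>

lemma sinh_functional_eq:
  "(1 - fps_X) * fps_odd_part (qexp q) = fps_dilate q (fps_odd_part (qexp q)) + fps_X * qexp_neg q"
proof (rule fps_ext)
  fix n
  show "fps_nth ((1 - fps_X) * fps_odd_part (qexp q)) n =
    fps_nth (fps_dilate q (fps_odd_part (qexp q)) + fps_X * qexp_neg q) n"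
    using nz nz_factor
    by (cases n)
       (auto simp: fps_nth_dilate fps_odd_part_def qexp_def qexp_neg_def qpoch_Suc
          left_diff_distrib divide_simps)
qed

lemma G_q_mult_qexp_neg: "G_q q * qexp_neg q = fps_odd_part (qexp q)"
proof -
  let ?D = "G_q q * qexp_neg q - fps_odd_part (qexp q)"
  have "(1 - fps_X) * (G_q q * qexp_neg q) = ((1 - fps_X) * G_q q) * qexp_neg q"
    by (simp only: mult.assoc)
  also have "\<dots> = fps_dilate q (G_q q) * ((1 + fps_X) * qexp_neg q) + fps_X * qexp_neg q"
    unfolding G_q_functional_eq by (simp add: algebra_simps)
  \<comment> \<open>Dilating e(-x) produces exactly the factor 1 + x left over from the equation for
    \<open>G_q\<close>.\<close>
  also have "\<dots> = fps_dilate q (G_q q * qexp_neg q) + fps_X * qexp_neg q"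
    by (simp only: fps_dilate_mult dilate_qexp_neg)
  finally have "(1 - fps_X) * ?D = fps_dilate q ?D"
    unfolding right_diff_distrib[of "1 - fps_X"] fps_dilate_diff sinh_functional_eq by simp
  moreover have "fps_nth ?D 0 = 0"
    by (simp add: G_q_def fps_odd_part_def)
  ultimately have "?D = 0"
    using one_minus_X_mult_eq_dilate_imp_0 q by blast
  then show ?thesis by simp
qed

lemma even_G_q_mult_cosh:
  "fps_even_part (G_q q) * fps_even_part (qexp q) = fps_odd_part (G_q q) * fps_odd_part (qexp q)"
  (is "?B * ?C = ?A * ?S")
proof -
  have "fps_nth (?B * ?C - ?A * ?S) n = 0" for n
  proof -
    \<comment> \<open>For even \<open>n\<close>, i and n - i have equal parity, and the minus sign
      is that of e(-x) at odd indices; for odd \<open>n\<close> all terms vanish.\<close>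
    have "fps_nth (?B * ?C - ?A * ?S) n =
      (\<Sum>i=0..n. if even n then fps_nth (G_q q) i * fps_nth (qexp_neg q) (n - i) else 0)"
      unfolding fps_sub_nth fps_mult_nth sum_subtractf[symmetric]
      by (rule sum.cong)
         (auto simp: fps_even_part_def fps_odd_part_def qexp_def qexp_neg_def)
    also have "\<dots> = (if even n then fps_nth (fps_odd_part (qexp q)) n else 0)"
      by (simp add: fps_mult_nth flip: G_q_mult_qexp_neg)
    finally show ?thesis by (simp add: fps_odd_part_def)
  qed
  then show ?thesis by (simp add: fps_eq_iff)
qed

end

lemma cosh_mult_signed_tan:
  "fps_even_part (qexp q) * signed_tan_q q = fps_odd_part (qexp q)"
proof (rule fps_ext)
  fix n
  have "fps_nth (cos_q q) 0 = 1"
    by (simp add: cos_q_def)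
  then have tan: "cos_q q * (sin_q q / cos_q q) = sin_q q"
    by (simp add: fps_divide_unit inverse_mult_eq_1' mult.left_commute mult.commute)
  have "fps_nth (fps_even_part (qexp q) * signed_tan_q q) n =
    (\<Sum>i=0..n. if odd n then (-1) ^ (n div 2) *
       (fps_nth (cos_q q) i * fps_nth (sin_q q / cos_q q) (n - i)) else 0)"
    unfolding fps_mult_nth
  proof (rule sum.cong[OF refl])
    fix i assume "i \<in> {0..n}"
    then have i: "i \<le> n" by simp
    \<comment> \<open>For even \<open>i\<close> the two halves add up to n div 2, so the sign of
      \<open>cos_q\<close> turns that of the tangent into a factor independent of
      \<open>i\<close>.\<close>
    have sgn: "(-1) ^ ((n - i) div 2) = (-1 :: 'a) ^ (n div 2) * (-1) ^ (i div 2)" if "even i"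
    proof -
      from that obtain k where k: "i = 2 * k" by blast
      with i have "n div 2 = (n - i) div 2 + k" by simp
      then show ?thesis by (simp add: k power_add)
    qed
    show "fps_nth (fps_even_part (qexp q)) i * fps_nth (signed_tan_q q) (n - i) =
      (if odd n then (-1) ^ (n div 2) *
       (fps_nth (cos_q q) i * fps_nth (sin_q q / cos_q q) (n - i)) else 0)"
      using i
      by (auto simp: fps_even_part_def qexp_def signed_tan_q_def cos_q_def sgn)
  qed
  also have "\<dots> = (if odd n then (-1) ^ (n div 2) * fps_nth (cos_q q * (sin_q q / cos_q q)) n else 0)"
    by (simp add: fps_mult_nth sum_distrib_left)
  also have "\<dots> = fps_nth (fps_odd_part (qexp q)) n"
    unfolding tan by (simp add: sin_q_def fps_odd_part_def qexp_def)
  finally show "fps_nth (fps_even_part (qexp q) * signed_tan_q q) n =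
    fps_nth (fps_odd_part (qexp q)) n" .
qed

text \<open>Both sides agree after multiplication by \<open>C\<close>, which can be cancelled
  because its constant term is 1.\<close>

lemma signed_tan_mult_odd_G_q:
  fixes q :: "'a::field"
  assumes "\<And>m. m \<ge> 1 \<Longrightarrow> q ^ m \<noteq> 1"
  shows "signed_tan_q q * fps_odd_part (G_q q) = fps_even_part (G_q q)"
proof -
  let ?C = "fps_even_part (qexp q)"
  have "?C * (signed_tan_q q * fps_odd_part (G_q q)) = ?C * fps_even_part (G_q q)"
    using even_G_q_mult_cosh[OF assms]
    by (metis cosh_mult_signed_tan mult.assoc mult.commute)
  moreover have "fps_nth ?C 0 \<noteq> 0"
    by (simp add: fps_even_part_def qexp_def)
  then have "?C \<noteq> 0" by (metis fps_zero_nth)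
  ultimately show ?thesis by simp
qed

theorem theorem2p1:
  fixes q :: "'a::field" and n :: nat
  assumes "\<And>m. m \<ge> 1 \<Longrightarrow> q ^ m \<noteq> 1"
    and "n \<ge> 1"
  shows "(\<Sum>k=0..n-1. qbinom q (2*n) (2*k+1) * qpoch (-q) q (2*n-2*k-2)
            * (-1) ^ k * q_tangent_number q (2*k+1))
         = qpoch (-q) q (2*n-1)"
proof -
  have nz: "qpoch q q m \<noteq> 0" for m
    by (rule qpoch_nonzero) (rule assms(1))
  let ?t = "\<lambda>i. fps_nth (signed_tan_q q) i * fps_nth (fps_odd_part (G_q q)) (2*n - i)"
  have "(\<Sum>k=0..n-1. qbinom q (2*n) (2*k+1) * qpoch (-q) q (2*n-2*k-2)
            * (-1) ^ k * q_tangent_number q (2*k+1))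
        = (\<Sum>k=0..n-1. qpoch q q (2*n) * ?t (2*k+1))"
  proof (rule sum.cong[OF refl])
    fix k assume "k \<in> {0..n-1}"
    \<comment> \<open>With n >= 1, 2k+1 stays below 2n, which avoids the zero branches of
      \<open>qbinom\<close> and \<open>G_q\<close>.\<close>
    with assms(2) have k: "2*k+1 \<le> 2*n" "odd (2*n - (2*k+1))" "2*n - (2*k+1) \<noteq> 0"
      "2*n - (2*k+1) - 1 = 2*n - 2*k - 2"
      by auto
    have G: "fps_nth (fps_odd_part (G_q q)) (2*n - (2*k+1)) =
        qpoch (-q) q (2*n-2*k-2) / qpoch q q (2*n - (2*k+1))"
      using k unfolding fps_odd_part_def G_q_def fps_nth_Abs_fps by (simp only: if_True if_False not_False_eq_True)
    have T: "fps_nth (signed_tan_q q) (2*k+1) =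
        (-1) ^ k * (q_tangent_number q (2*k+1) / qpoch q q (2*k+1))"
      using nz by (simp add: signed_tan_q_def q_tangent_number_def)
    show "qbinom q (2*n) (2*k+1) * qpoch (-q) q (2*n-2*k-2)
            * (-1) ^ k * q_tangent_number q (2*k+1) = qpoch q q (2*n) * ?t (2*k+1)"
      unfolding G T qbinom_def using k(1) by (simp only: if_True) (simp add: field_simps)
  qed
  also have "\<dots> = qpoch q q (2*n) * (\<Sum>k=0..n-1. ?t (2*k+1))"
    by (simp add: sum_distrib_left)
  also have "(\<Sum>k=0..n-1. ?t (2*k+1)) = (\<Sum>i\<in>(\<lambda>k. 2*k+1) ` {0..n-1}. ?t i)"
    by (subst sum.reindex) (auto simp: inj_on_def)
  \<comment> \<open>The even indices are added to complete the Cauchy product; the signed tangent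
    vanishes there.\<close>
  also have "\<dots> = (\<Sum>i=0..2*n. ?t i)"
  proof (rule sum.mono_neutral_left)
    show "(\<lambda>k. 2*k+1) ` {0..n-1} \<subseteq> {0..2*n}"
      using assms(2) by auto
    show "\<forall>i\<in>{0..2*n} - (\<lambda>k. 2*k+1) ` {0..n-1}. ?t i = 0"
    proof
      fix i assume i: "i \<in> {0..2*n} - (\<lambda>k. 2*k+1) ` {0..n-1}"
      have "even i"
      proof (rule ccontr)
        assume "odd i"
        then obtain k where k: "i = 2*k+1" by (elim oddE)
        with i have "k \<in> {0..n-1}" by auto
        with i k show False by blast
      qed
      then show "?t i = 0" by (simp add: signed_tan_q_def)
    qed
  qed simp
  also have "\<dots> = fps_nth (fps_even_part (G_q q)) (2*n)"
    by (simp add: fps_mult_nth flip: signed_tan_mult_odd_G_q[OF assms(1)])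
  also have "qpoch q q (2*n) * \<dots> = qpoch (-q) q (2*n-1)"
    using nz assms(2) by (simp add: fps_even_part_def G_q_def)
  finally show ?thesis .
qed

end
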